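(* Let $f:\mathbb{Z}^{+}\to\mathbb{R}^{+}$ and let $n$ be a positive integer such that $\frac{n^2}{4}-nf(n)$ is an integer and $f(n)\le\frac{n}{1000}$. Then $$\gamma(n,f)\ \ge\ \min\left\{\frac{n}{50\sqrt{f(n)}},\ \frac{n^2}{2500f(n)^2},\ \frac{n}{1000}\right\}.$$
   Context: Graphs are finite and simple. A book of size $q$ in a graph is a set of $q$ triangles sharing a common edge. $bk(G)$ denotes the size of the largest book in $G$, i.e. the maximum over edges $e$ of $G$ of the number of triangles of $G$ containing $e$ ($0$ if $G$ has no edges). For a function $f:\mathbb{Z}^{+}\to\mathbb{R}^{+}$, $\gamma(n,f)$ is the minimal value of $bk(G)$ over all graphs $G$ with $n$ vertices and at least $\left\lceil\frac{n^2}{4}-nf(n)\right\rceil$ edges such that every edge of $G$ is contained in at least one triangle. *)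

theory Defs
  imports Complex_Main
begin

text \<open>A finite simple graph is given by its vertex set and a set of two-element sets of vertices.\<close>

definition simple_graph :: "'a set \<Rightarrow> 'a set set \<Rightarrow> bool" where
  "simple_graph V E \<longleftrightarrow> finite V \<and> (\<forall>e\<in>E. e \<subseteq> V \<and> card e = 2)"

definition triangles :: "'a set \<Rightarrow> 'a set set \<Rightarrow> 'a set set" where
  "triangles V E = {T. T \<subseteq> V \<and> card T = 3 \<and> (\<forall>e. e \<subseteq> T \<and> card e = 2 \<longrightarrow> e \<in> E)}"

definition triangles_on :: "'a set \<Rightarrow> 'a set set \<Rightarrow> 'a set \<Rightarrow> 'a set set" where
  "triangles_on V E e = {T \<in> triangles V E. e \<subseteq> T}"

definition bk :: "'a set \<Rightarrow> 'a set set \<Rightarrow> nat" where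
  "bk V E = (if E = {} then 0 else Max ((\<lambda>e. card (triangles_on V E e)) ` E))"

text \<open>
  Vertices are natural numbers; every finite graph is isomorphic to such a graph.
  The edge threshold is an integer and may be negative for arbitrary \<open>f\<close>.
  The value \<open>gamma n f\<close> is meaningful only if at least one graph is admissible.
  For \<open>n \<ge> 3\<close> and positive \<open>f\<close>, the complete graph is.
\<close>

definition admissible :: "nat \<Rightarrow> (nat \<Rightarrow> real) \<Rightarrow> nat set \<Rightarrow> nat set set \<Rightarrow> bool" where
  "admissible n f V E \<longleftrightarrow>
     simple_graph V E \<and> card V = n \<and>
     int (card E) \<ge> \<lceil>(real n)\<^sup>2 / 4 - real n * f n\<rceil> \<and>
     (\<forall>e\<in>E. triangles_on V E e \<noteq> {})"

definition gamma :: "nat \<Rightarrow> (nat \<Rightarrow> real) \<Rightarrow> nat" where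
  "gamma n f = (LEAST b. \<exists>V E. admissible n f V E \<and> bk V E = b)"

end

theory Submission
  imports Defs "HOL-Analysis.Convex"
begin

text \<open>
  Write \<open>t = f n\<close> and let \<open>b\<close> be the size of the largest book. Some edge \<open>uv\<close> has degree sum at least
  \<open>n - 4t\<close>, and since neighbourhoods induce graphs of maximum degree at most \<open>b\<close>, cutting along
  \<open>N u\<close> leaves few edges inside the parts. Hence a maximum cut is almost complete bipartite, and
  bootstrapping this shows that it misses only \<open>O(tn)\<close> cross pairs. The two ends of an edge inside a
  part have at most \<open>b\<close> common neighbours, so one of them lies in the set \<open>X\<close> of vertices missing a
  positive proportion of the other part, and \<open>|X| = O(t)\<close>.

  If every cross edge is in a triangle, then each cross edge either meets \<open>X\<close> (few do), or has
  an apex \<open>w\<close> in \<open>X\<close>. If \<open>w\<close> has fewer than \<open>b + 10t\<close> neighbours in its own part, it serves at most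
  \<open>b(b + 10t)\<close> cross edges, in total \<open>O(tb(b + t))\<close>. Otherwise both ends of the edge miss at least
  \<open>10t\<close> vertices, and there are only few such pairs. So \<open>tb\<^sup>2 + t\<^sup>2b\<close> has order at least \<open>n\<^sup>2\<close>.
\<close>

section \<open>Double counting and averaging for finite sums\<close>

lemma sum_symmetric_relation:
  fixes g :: "'a \<Rightarrow> real"
  assumes "finite V" "\<And>v. R v \<subseteq> V" "\<And>v w. w \<in> R v \<Longrightarrow> v \<in> R w"
  shows "(\<Sum>v\<in>V. \<Sum>w\<in>R v. g w) = (\<Sum>v\<in>V. real (card (R v)) * g v)"
proof -
  have fR: "finite (R v)" for v using assms finite_subset by blast
  have R: "R v = {w \<in> V. w \<in> R v}" for v using assms(2) by auto
  have "(\<Sum>v\<in>V. \<Sum>w\<in>R v. g w) = (\<Sum>v\<in>V. \<Sum>w\<in>{w \<in> V. w \<in> R v}. g w)"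
    by (subst R) simp
  also have "\<dots> = (\<Sum>w\<in>V. \<Sum>v\<in>{v \<in> V. w \<in> R v}. g w)"
    by (rule sum.swap_restrict) (use assms in auto)
  also have "\<dots> = (\<Sum>w\<in>V. \<Sum>v\<in>R w. g w)"
    using assms(2,3) by (intro sum.cong) blast+
  finally show ?thesis by simp
qed

text \<open>Row and column of \<open>v\<close> contribute equally by symmetry, and their common
  entry is zero. This isolates the effect of moving one vertex across a cut.\<close>

lemma double_sum_remove:
  fixes F :: "'a \<Rightarrow> 'a \<Rightarrow> real"
  assumes "finite V" "v \<in> V" "\<And>u w. F u w = F w u" "F v v = 0"
  shows "(\<Sum>u\<in>V. \<Sum>w\<in>V. F u w) =
    2 * (\<Sum>w\<in>V. F v w) + (\<Sum>u\<in>V - {v}. \<Sum>w\<in>V - {v}. F u w)"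
proof -
  have "(\<Sum>w\<in>V. F u w) = F v u + (\<Sum>w\<in>V - {v}. F u w)" for u
    using assms by (simp add: sum.remove[of V v])
  then have "(\<Sum>u\<in>V - {v}. \<Sum>w\<in>V. F u w) =
      (\<Sum>u\<in>V - {v}. F v u) + (\<Sum>u\<in>V - {v}. \<Sum>w\<in>V - {v}. F u w)"
    by (simp add: sum.distrib)
  moreover have "(\<Sum>u\<in>V - {v}. F v u) = (\<Sum>u\<in>V. F v u)"
    using assms by (simp add: sum.remove[of V v])
  ultimately show ?thesis
    using sum.remove[of V v "\<lambda>u. \<Sum>w\<in>V. F u w"] assms by simp
qed

text \<open>Markov's inequality, in the form that bounds the number of vertices with many missing
  pairs.\<close>

lemma card_times_threshold_le_sum:
  fixes g :: "'a \<Rightarrow> nat"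
  assumes "finite V" "X \<subseteq> V" "\<And>x. x \<in> X \<Longrightarrow> c \<le> real (g x)"
  shows "c * real (card X) \<le> (\<Sum>v\<in>V. real (g v))"
proof -
  have "c * real (card X) = (\<Sum>x\<in>X. c)" by simp
  also have "\<dots> \<le> (\<Sum>x\<in>X. real (g x))" using assms by (intro sum_mono) auto
  also have "\<dots> \<le> (\<Sum>v\<in>V. real (g v))" using assms by (intro sum_mono2) auto
  finally show ?thesis .
qed

section \<open>Cuts in graphs with bounded books\<close>

locale book_graph =
  fixes V :: "'a set" and N :: "'a \<Rightarrow> 'a set" and b :: nat
  assumes finite_V: "finite V"
    and N_subset: "N v \<subseteq> V"
    and N_sym: "w \<in> N v \<Longrightarrow> v \<in> N w"
    and N_irrefl: "v \<notin> N v"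
    and book: "w \<in> N v \<Longrightarrow> card (N v \<inter> N w) \<le> b"
begin

text \<open>A cut is a Boolean labelling \<open>s\<close>. This treats both sides alike and makes
  moving a vertex a function update.\<close>

definition same :: "('a \<Rightarrow> bool) \<Rightarrow> 'a \<Rightarrow> 'a set" where
  "same s v = {w \<in> N v. s w = s v}"

definition cross :: "('a \<Rightarrow> bool) \<Rightarrow> 'a \<Rightarrow> 'a set" where
  "cross s v = {w \<in> N v. s w \<noteq> s v}"

definition opp :: "('a \<Rightarrow> bool) \<Rightarrow> 'a \<Rightarrow> 'a set" where
  "opp s v = {w \<in> V. s w \<noteq> s v}"

definition miss :: "('a \<Rightarrow> bool) \<Rightarrow> 'a \<Rightarrow> 'a set" where
  "miss s v = opp s v - N v"

lemma finite_N [simp]: "finite (N v)"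
  using finite_V N_subset finite_subset by blast

lemma finite_sets [simp]:
  "finite (same s v)" "finite (cross s v)" "finite (opp s v)" "finite (miss s v)"
  using finite_V by (auto simp: same_def cross_def opp_def miss_def)

lemma card_N: "card (N v) = card (same s v) + card (cross s v)"
proof -
  have "N v = same s v \<union> cross s v" "same s v \<inter> cross s v = {}"
    by (auto simp: same_def cross_def)
  then show ?thesis by (metis card_Un_disjoint finite_sets(1,2))
qed

lemma card_opp: "card (opp s v) = card (miss s v) + card (cross s v)"
proof -
  have "opp s v = miss s v \<union> cross s v" "miss s v \<inter> cross s v = {}"
    using N_subset by (auto simp: opp_def miss_def cross_def)
  then show ?thesis by (metis card_Un_disjoint finite_sets(2,4))
qed

text \<open>A vertex of \<open>T\<close> adjacent to \<open>y\<close> is a common neighbour of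
  \<open>x\<close> and \<open>y\<close>, and the book bound allows at most \<open>b\<close> of
  these; \<open>y\<close> misses the others.\<close>

lemma card_le_book_miss:
  assumes "y \<in> N x" "T \<subseteq> N x" "T \<subseteq> opp s y"
  shows "card T \<le> b + card (miss s y)"
proof -
  have "T \<subseteq> (N x \<inter> N y) \<union> miss s y" using assms by (auto simp: miss_def)
  then have "card T \<le> card ((N x \<inter> N y) \<union> miss s y)" by (intro card_mono) auto
  also have "\<dots> \<le> card (N x \<inter> N y) + card (miss s y)" by (rule card_Un_le)
  finally show ?thesis using book[OF assms(1)] by linarith
qed

text \<open>Adjacent vertices on one side face the same opposite side, and each vertex there is a
  common neighbour or is missed by one of the two.\<close>

lemma opp_le_book_miss:
  assumes "y \<in> same s x"
  shows "card (opp s x) \<le> b + card (miss s x) + card (miss s y)"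
proof -
  have "opp s x \<subseteq> ((N x \<inter> N y) \<union> miss s x) \<union> miss s y"
    using assms by (auto simp: miss_def opp_def same_def)
  then have "card (opp s x) \<le> card (((N x \<inter> N y) \<union> miss s x) \<union> miss s y)"
    by (intro card_mono) auto
  also have "\<dots> \<le> card (N x \<inter> N y) + card (miss s x) + card (miss s y)"
    by (meson add_right_mono card_Un_le le_trans)
  finally show ?thesis using book[of y x] assms by (simp add: same_def)
qed

lemma sum_same: "(\<Sum>v\<in>V. \<Sum>w\<in>same s v. g w) = (\<Sum>v\<in>V. real (card (same s v)) * g v)"
  by (rule sum_symmetric_relation) (use finite_V N_subset N_sym in \<open>auto simp: same_def\<close>)

text \<open>Each neighbour \<open>y\<close> of \<open>x\<close> has at most \<open>b\<close> neighbours in \<open>N x\<close>, so it misses almost all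
  neighbours of \<open>x\<close> on the side opposite to \<open>y\<close>.\<close>
lemma same_cross_miss:
  "real (card (same s x)) * (real (card (cross s x)) - b)
    + real (card (cross s x)) * (real (card (same s x)) - b)
    \<le> (\<Sum>v\<in>V. real (card (miss s v)))"
proof -
  have 1: "real (card (same s x)) * (real (card (cross s x)) - b) \<le> (\<Sum>y\<in>same s x. real (card (miss s y)))"
  proof (rule sum_bounded_below)
    fix y assume "y \<in> same s x"
    then have "card (cross s x) \<le> b + card (miss s y)"
      using N_subset by (intro card_le_book_miss[of y x]) (auto simp: same_def cross_def opp_def)
    then show "real (card (cross s x)) - b \<le> real (card (miss s y))" by simp
  qed
  have 2: "real (card (cross s x)) * (real (card (same s x)) - b) \<le> (\<Sum>y\<in>cross s x. real (card (miss s y)))"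
  proof (rule sum_bounded_below)
    fix y assume "y \<in> cross s x"
    then have "card (same s x) \<le> b + card (miss s y)"
      using N_subset by (intro card_le_book_miss[of y x]) (auto simp: same_def cross_def opp_def)
    then show "real (card (same s x)) - b \<le> real (card (miss s y))" by simp
  qed
  have "(\<Sum>y\<in>same s x. real (card (miss s y))) + (\<Sum>y\<in>cross s x. real (card (miss s y)))
      = (\<Sum>y\<in>same s x \<union> cross s x. real (card (miss s y)))"
    by (rule sum.union_disjoint[symmetric]) (auto simp: same_def cross_def)
  also have "\<dots> \<le> (\<Sum>v\<in>V. real (card (miss s v)))"
    using finite_V N_subset by (intro sum_mono2) (auto simp: same_def cross_def)
  finally show ?thesis using 1 2 by linarith
qed

text \<open>The move exchanges inner and cross neighbours of \<open>v\<close>; the factor 2 arises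
  because the sum counts ordered pairs.\<close>

lemma sum_cross_flip:
  assumes "v \<in> V"
  shows "(\<Sum>u\<in>V. real (card (cross (s(v := \<not> s v)) u))) =
    (\<Sum>u\<in>V. real (card (cross s u))) + 2 * real (card (same s v)) - 2 * real (card (cross s v))"
proof -
  \<comment> \<open>As an indicator on ordered pairs the cut size is a symmetric double sum; only
    row and column \<open>v\<close> notice the flip.\<close>
  define F where "F (s :: 'a \<Rightarrow> bool) u w = (if w \<in> N u \<and> s w \<noteq> s u then 1 else 0 :: real)" for s u w
  have F: "real (card (cross s u)) = (\<Sum>w\<in>V. F s u w)" for s u
  proof -
    have "(\<Sum>w\<in>V. F s u w) = (\<Sum>w\<in>{w \<in> V. w \<in> N u \<and> s w \<noteq> s u}. 1)"
      unfolding F_def using finite_V by (intro sum.inter_filter[symmetric]) auto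
    also have "{w \<in> V. w \<in> N u \<and> s w \<noteq> s u} = cross s u"
      using N_subset by (auto simp: cross_def)
    finally show ?thesis by simp
  qed
  let ?s = "s(v := \<not> s v)"
  have D: "(\<Sum>u\<in>V. \<Sum>w\<in>V. F s u w) =
    2 * (\<Sum>w\<in>V. F s v w) + (\<Sum>u\<in>V - {v}. \<Sum>w\<in>V - {v}. F s u w)" for s
    by (rule double_sum_remove) (use finite_V assms N_sym in \<open>auto simp: F_def\<close>)
  have rest: "(\<Sum>u\<in>V - {v}. \<Sum>w\<in>V - {v}. F ?s u w) = (\<Sum>u\<in>V - {v}. \<Sum>w\<in>V - {v}. F s u w)"
    by (intro sum.cong) (auto simp: F_def)
  have "cross ?s v = same s v"
    using N_irrefl by (auto simp: cross_def same_def)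
  then have "real (card (same s v)) = (\<Sum>w\<in>V. F ?s v w)" using F by metis
  with D[of s] D[of ?s] rest F[of s v] show ?thesis by (simp only: F)
qed

lemma sum_cross_le: "(\<Sum>u\<in>V. card (cross s u)) \<le> card V * card V"
proof -
  have "card (cross s u) \<le> card V" for u
    using finite_V N_subset by (intro card_mono) (auto simp: cross_def)
  then show ?thesis using sum_bounded_above[of V "\<lambda>u. card (cross s u)" "card V"] by simp
qed

text \<open>Cut sizes are bounded, so a largest one exists; if a vertex had more inner than cross
  neighbours, flipping it would enlarge the cut.\<close>

lemma max_cut_exists:
  obtains s where "\<And>s'. (\<Sum>u\<in>V. card (cross s' u)) \<le> (\<Sum>u\<in>V. card (cross s u))"
    "\<And>v. v \<in> V \<Longrightarrow> card (same s v) \<le> card (cross s v)"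
proof -
  obtain s where s: "\<And>s'. (\<Sum>u\<in>V. card (cross s' u)) \<le> (\<Sum>u\<in>V. card (cross s u))"
    using ex_has_greatest_nat[of "\<lambda>_. True" undefined "\<lambda>s. \<Sum>u\<in>V. card (cross s u)" "card V * card V + 1"]
      sum_cross_le by (metis Suc_eq_plus1 le_imp_less_Suc)
  moreover have "card (same s v) \<le> card (cross s v)" if "v \<in> V" for v
  proof -
    have "(\<Sum>u\<in>V. real (card (cross (s(v := \<not> s v)) u))) \<le> (\<Sum>u\<in>V. real (card (cross s u)))"
      using s[of "s(v := \<not> s v)"] by (metis of_nat_le_iff of_nat_sum)
    with sum_cross_flip[OF that, of s] show ?thesis by simp
  qed
  ultimately show thesis by (rule that)
qed

text \<open>Averaged over ordered adjacent pairs, the degree sum is twice the sum of squared degrees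
  divided by the sum of degrees. By Cauchy-Schwarz this is at least twice the mean degree.\<close>

lemma heavy_edge:
  fixes c :: real
  assumes D: "(\<Sum>v\<in>V. real (card (N v))) \<ge> real (card V) * c" and c: "c > 0" and "V \<noteq> {}"
  obtains u v where "u \<in> V" "v \<in> N u" "real (card (N u)) + real (card (N v)) \<ge> 2 * c"
proof (rule ccontr)
  assume "\<not> thesis"
  note no = this that
  have less: "real (card (N u)) + real (card (N v)) < 2 * c" if "u \<in> V" "v \<in> N u" for u v
    using no that by (meson linorder_not_less)
  let ?d = "\<lambda>v. real (card (N v))" and ?D = "\<Sum>v\<in>V. real (card (N v))"
  have n: "real (card V) > 0" using finite_V \<open>V \<noteq> {}\<close> by (simp add: card_gt_0_iff)
  then have Dpos: "?D > 0" using D c by (smt (verit) mult_pos_pos)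
  \<comment> \<open>Strictness of the summed inequality requires at least one edge.\<close>
  then obtain u0 where u0: "u0 \<in> V" "N u0 \<noteq> {}"
    by (metis card.empty less_irrefl of_nat_0 sum.neutral)
  have "(\<Sum>u\<in>V. \<Sum>v\<in>N u. ?d u + ?d v) < (\<Sum>u\<in>V. \<Sum>v\<in>N u. 2 * c)"
  proof (rule sum_strict_mono_ex1)
    show "\<forall>u\<in>V. (\<Sum>v\<in>N u. ?d u + ?d v) \<le> (\<Sum>v\<in>N u. 2 * c)"
      by (intro ballI sum_mono order_less_imp_le less)
    show "\<exists>u\<in>V. (\<Sum>v\<in>N u. ?d u + ?d v) < (\<Sum>v\<in>N u. 2 * c)"
    proof (rule bexI)
      show "(\<Sum>v\<in>N u0. ?d u0 + ?d v) < (\<Sum>v\<in>N u0. 2 * c)"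
        using u0 less by (intro sum_strict_mono) auto
    qed (rule u0)
  qed (use finite_V in auto)
  moreover have "(\<Sum>u\<in>V. \<Sum>v\<in>N u. 2 * c) = 2 * c * ?D"
    by (simp add: sum_distrib_left mult.commute)
  moreover have "(\<Sum>u\<in>V. \<Sum>v\<in>N u. ?d v) = (\<Sum>u\<in>V. ?d u * ?d u)"
    by (rule sum_symmetric_relation) (use finite_V N_subset N_sym in auto)
  ultimately have "(\<Sum>u\<in>V. ?d u * ?d u) < c * ?D"
    by (simp add: sum.distrib)
  then have "real (card V) * (\<Sum>u\<in>V. ?d u * ?d u) < (real (card V) * c) * ?D"
    using n by (simp add: mult.assoc)
  also have "\<dots> \<le> ?D * ?D" using D Dpos by (intro mult_right_mono) auto
  also have "\<dots> \<le> real (card V) * (\<Sum>u\<in>V. ?d u * ?d u)"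
    using sum_squared_le_sum_of_squares[of ?d V] finite_V
    by (cases "V = {}") (auto simp: power2_eq_square mult.commute)
  finally show False by simp
qed

text \<open>Vertices of \<open>N u\<close> have at most \<open>b\<close> inner neighbours by the
  book bound at \<open>u\<close>. Those of \<open>N v\<close> outside \<open>N u\<close> have at
  most \<open>b\<close> within \<open>N v\<close>, plus the uncovered vertices. An uncovered vertex
  gets the trivial bound.\<close>

lemma neighbourhood_cut:
  assumes "v \<in> N u"
  shows "(\<Sum>w\<in>V. card (same (\<lambda>w. w \<in> N u) w)) \<le>
    card V * (b + 2 * card (V - (N u \<union> N v)))"
proof -
  let ?s = "\<lambda>w. w \<in> N u" and ?R = "V - (N u \<union> N v)"
  have fR: "finite ?R" using finite_V by simp
  have "card (same ?s w) \<le> b + card ?R + (if w \<in> ?R then card V else 0)" if "w \<in> V" for w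
  proof -
    consider "w \<in> N u" | "w \<notin> N u" "w \<in> N v" | "w \<in> ?R" using \<open>w \<in> V\<close> by blast
    then show ?thesis
    proof cases
      case 1
      then have "same ?s w = N u \<inter> N w" by (auto simp: same_def)
      then show ?thesis using book[OF 1] by simp
    next
      case 2
      have "same ?s w \<subseteq> (N v \<inter> N w) \<union> ?R"
        using 2 N_subset by (auto simp: same_def)
      then have "card (same ?s w) \<le> card ((N v \<inter> N w) \<union> ?R)"
        using fR by (intro card_mono) auto
      also have "\<dots> \<le> card (N v \<inter> N w) + card ?R" by (rule card_Un_le)
      finally show ?thesis using book[OF 2(2)] by simp
    next
      case 3
      have "card (same ?s w) \<le> card V"
        using finite_V N_subset by (intro card_mono) (auto simp: same_def)
      then show ?thesis using 3 by simp
    qed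
  qed
  then have "(\<Sum>w\<in>V. card (same ?s w)) \<le> (\<Sum>w\<in>V. b + card ?R + (if w \<in> ?R then card V else 0))"
    by (rule sum_mono)
  also have "\<dots> = card V * (b + card ?R) + (\<Sum>w\<in>V. if w \<in> ?R then card V else 0)"
    by (simp add: sum.distrib)
  also have "(\<Sum>w\<in>V. if w \<in> ?R then card V else 0) = (\<Sum>w\<in>V \<inter> ?R. card V)"
    by (rule sum.inter_restrict[OF finite_V, symmetric])
  also have "V \<inter> ?R = ?R" by blast
  finally show ?thesis by (simp add: algebra_simps)
qed

text \<open>Counts the cross edges \<open>uv\<close> forming a triangle with apex \<open>w\<close>
  on the side of \<open>u\<close>: each edge \<open>wu\<close> lies in at most \<open>b\<close>
  triangles.\<close>

lemma card_triangle_pairs: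
  "card (SIGMA u:same s w. cross s w \<inter> N u) \<le> card (same s w) * b"
proof -
  have "card (SIGMA u:same s w. cross s w \<inter> N u) = (\<Sum>u\<in>same s w. card (cross s w \<inter> N u))"
    by (rule card_SigmaI) auto
  also have "\<dots> \<le> (\<Sum>u\<in>same s w. b)"
  proof (rule sum_mono)
    fix u assume u: "u \<in> same s w"
    have "card (cross s w \<inter> N u) \<le> card (N w \<inter> N u)"
      by (intro card_mono) (auto simp: cross_def)
    then show "card (cross s w \<inter> N u) \<le> b" using book[of u w] u by (simp add: same_def)
  qed
  finally show ?thesis by simp
qed

lemma sum_opp_le: "2 * (\<Sum>v\<in>V. card (opp s v)) \<le> card V * card V"
proof -
  let ?A = "{w \<in> V. s w}" and ?B = "{w \<in> V. \<not> s w}"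
  have VAB: "V = ?A \<union> ?B" and fin: "finite ?A" "finite ?B" using finite_V by auto
  have n: "card V = card ?A + card ?B"
    by (subst VAB, rule card_Un_disjoint) (use fin in auto)
  have "(\<Sum>v\<in>V. card (opp s v)) = (\<Sum>v\<in>?A. card (opp s v)) + (\<Sum>v\<in>?B. card (opp s v))"
    by (subst VAB, rule sum.union_disjoint) (use fin in auto)
  also have "(\<Sum>v\<in>?A. card (opp s v)) = (\<Sum>v\<in>?A. card ?B)"
    by (intro sum.cong refl arg_cong[of _ _ card]) (auto simp: opp_def)
  also have "(\<Sum>v\<in>?B. card (opp s v)) = (\<Sum>v\<in>?B. card ?A)"
    by (intro sum.cong refl arg_cong[of _ _ card]) (auto simp: opp_def)
  finally have "(\<Sum>v\<in>V. card (opp s v)) = 2 * (card ?A * card ?B)" by simp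
  moreover have "4 * (a * b) \<le> (a + b) * (a + b)" for a b :: nat
  proof -
    have "0 \<le> (int a - int b)\<^sup>2" by simp
    then have "int (4 * (a * b)) \<le> int ((a + b) * (a + b))"
      by (simp add: power2_eq_square algebra_simps)
    then show ?thesis by (simp only: of_nat_le_iff)
  qed
  ultimately show ?thesis unfolding n by simp
qed

text \<open>In terms of one side's size, so that a large total forces balanced sides.\<close>

lemma sum_opp_eq:
  assumes "v \<in> V"
  shows "(\<Sum>w\<in>V. card (opp s w)) = 2 * card (opp s v) * (card V - card (opp s v))"
proof -
  let ?A = "opp s v" and ?B = "V - opp s v"
  have A: "?A \<subseteq> V" by (auto simp: opp_def)
  have "(\<Sum>w\<in>V. card (opp s w)) = (\<Sum>w\<in>?A. card (opp s w)) + (\<Sum>w\<in>?B. card (opp s w))"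
    using A finite_V by (metis add.commute sum.subset_diff)
  also have "(\<Sum>w\<in>?A. card (opp s w)) = (\<Sum>w\<in>?A. card ?B)"
    by (intro sum.cong refl arg_cong[of _ _ card]) (auto simp: opp_def)
  also have "(\<Sum>w\<in>?B. card (opp s w)) = (\<Sum>w\<in>?B. card ?A)"
    by (intro sum.cong refl arg_cong[of _ _ card]) (auto simp: opp_def)
  finally show ?thesis using A by (simp add: card_Diff_subset)
qed

section \<open>Structure of a maximum cut, and the count of its cross edges\<close>

theorem edges_not_all_in_triangles:
  fixes t :: real
  defines "n \<equiv> real (card V)"
  assumes "n > 0" and "0 < t" "t \<le> n / 1000" and "b \<le> n / 1000"
    and tb2: "t * (real b)\<^sup>2 \<le> n\<^sup>2 / 2500" and t2b: "t\<^sup>2 * b \<le> n\<^sup>2 / 2500"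
    and D: "(\<Sum>v\<in>V. real (card (N v))) \<ge> n\<^sup>2 / 2 - 2 * n * t"
  obtains v w where "w \<in> N v" "N v \<inter> N w = {}"
proof (rule ccontr)
  assume "\<not> thesis"
  then have tri: "N v \<inter> N w \<noteq> {}" if "w \<in> N v" for v w
    using that \<open>\<And>w v. w \<in> N v \<Longrightarrow> N v \<inter> N w = {} \<Longrightarrow> thesis\<close> by blast
  let ?D = "\<Sum>v\<in>V. real (card (N v))"
  have bn: "b * n \<le> n\<^sup>2 / 1000" and tn: "t * n \<le> n\<^sup>2 / 1000"
    using mult_right_mono[OF \<open>b \<le> n / 1000\<close>, of n] mult_right_mono[OF \<open>t \<le> n / 1000\<close>, of n] \<open>n > 0\<close>
    by (simp_all add: power2_eq_square)
  have n2: "n\<^sup>2 > 0" using \<open>n > 0\<close> by simp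
  obtain s where s: "\<And>s'. (\<Sum>u\<in>V. card (cross s' u)) \<le> (\<Sum>u\<in>V. card (cross s u))"
    and max: "\<And>v. v \<in> V \<Longrightarrow> card (same s v) \<le> card (cross s v)"
    using max_cut_exists by blast
  \<comment> \<open>All sums run over ordered pairs, so \<open>H\<close>, \<open>K\<close>, \<open>Q\<close> are twice the numbers of inner edges,
    cross edges and missing cross pairs.\<close>
  define h where "h v = real (card (same s v))" for v
  define d where "d v = real (card (cross s v))" for v
  define m where "m v = real (card (miss s v))" for v
  define H where "H = (\<Sum>v\<in>V. h v)"
  define K where "K = (\<Sum>v\<in>V. d v)"
  define Q where "Q = (\<Sum>v\<in>V. m v)"
  have HK: "H + K = ?D" unfolding H_def K_def h_def d_def card_N[of _ s] by (simp add: sum.distrib)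
  have QK: "Q + K = real (\<Sum>v\<in>V. card (opp s v))"
    unfolding Q_def K_def m_def d_def card_opp by (simp add: sum.distrib)
  have "real (2 * (\<Sum>v\<in>V. card (opp s v))) \<le> real (card V * card V)"
    using sum_opp_le by (simp only: of_nat_le_iff)
  then have QK': "Q + K \<le> n\<^sup>2 / 2" unfolding QK n_def by (simp add: power2_eq_square)
  have nonneg: "0 \<le> h v" "0 \<le> d v" "0 \<le> m v" for v by (simp_all add: h_def d_def m_def)
  have Q0: "0 \<le> Q" unfolding Q_def by (intro sum_nonneg nonneg)

  \<comment> \<open>A heavy edge leaves at most \<open>4 * t + b\<close> vertices uncovered, so the
    cut along \<open>N u\<close> has inner sum at most \<open>3 * b * n + 8 * t * n\<close>. A
    maximum cut does no worse.\<close>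
  have H1: "H \<le> (11 / 1000) * n\<^sup>2"
  proof -
    have "V \<noteq> {}" using \<open>n > 0\<close> by (auto simp: n_def)
    moreover have "n * ((n - 4 * t) / 2) \<le> ?D"
      using D by (simp add: power2_eq_square field_simps)
    moreover have "(n - 4 * t) / 2 > 0" using \<open>n > 0\<close> \<open>t \<le> n / 1000\<close> by simp
    ultimately obtain u v where uv: "u \<in> V" "v \<in> N u"
      "real (card (N u)) + real (card (N v)) \<ge> 2 * ((n - 4 * t) / 2)"
      using heavy_edge n_def by blast
    let ?r = "card (V - (N u \<union> N v))"
    have "card (N u \<union> N v) + card (N u \<inter> N v) = card (N u) + card (N v)"
      using card_Un_Int[of "N u" "N v"] by simp
    moreover have "card (N u \<union> N v) + ?r = card V"
      using finite_V N_subset by (metis card_mono card_Diff_subset finite_N finite_UnI le_add_diff_inverse Un_least)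
    ultimately have r: "real ?r \<le> 4 * t + b" using uv(3) book[OF uv(2)] by (simp add: n_def)
    let ?s = "\<lambda>w. w \<in> N u"
    have "real (\<Sum>w\<in>V. card (same ?s w)) \<le> real (card V * (b + 2 * ?r))"
      using neighbourhood_cut[OF uv(2)] by (simp only: of_nat_le_iff)
    also have "\<dots> \<le> n * (b + 2 * (4 * t + b))"
      unfolding of_nat_mult n_def using r by (intro mult_left_mono) auto
    finally have 1: "(\<Sum>w\<in>V. real (card (same ?s w))) \<le> 3 * (b * n) + 8 * (t * n)"
      by (simp add: algebra_simps)
    have "(\<Sum>w\<in>V. real (card (same ?s w))) + (\<Sum>w\<in>V. real (card (cross ?s w))) = ?D"
      unfolding card_N[of _ ?s] by (simp add: sum.distrib)
    moreover have "(\<Sum>w\<in>V. real (card (cross ?s w))) \<le> K"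
      unfolding K_def d_def using s[of ?s] by (metis of_nat_le_iff of_nat_sum)
    ultimately show ?thesis using HK 1 bn tn by linarith
  qed
  have QH: "Q \<le> 2 * (t * n) + H" using QK' HK D by (simp add: algebra_simps)
  have Q1: "Q \<le> (13 / 1000) * n\<^sup>2" using QH H1 tn by linarith
  have K1: "K \<ge> (487 / 1000) * n\<^sup>2" using HK D H1 tn by (simp add: algebra_simps)

  \<comment> \<open>A side below \<open>41/100\<close> of \<open>n\<close> would give at most
    \<open>2 * 0.41 * 0.59 = 0.4838\<close> times \<open>n^2\<close> for \<open>Q + K\<close>, less
    than \<open>K1\<close> provides.\<close>
  have opp: "real (card (opp s v)) \<ge> (41 / 100) * n" if "v \<in> V" for v
  proof (rule ccontr)
    assume "\<not> ?thesis"
    then have o: "real (card (opp s v)) < (41 / 100) * n" by simp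
    have le: "card (opp s v) \<le> card V" using finite_V by (intro card_mono) (auto simp: opp_def)
    have "(487 / 1000) * n\<^sup>2 \<le> 2 * real (card (opp s v)) * (n - real (card (opp s v)))"
      using QK Q0 K1 sum_opp_eq[OF that, of s] le by (simp add: n_def of_nat_diff)
    moreover have "0 \<le> ((41 / 100) * n - real (card (opp s v))) * ((59 / 100) * n - real (card (opp s v)))"
      using o \<open>n > 0\<close> by (intro mult_nonneg_nonneg) auto
    ultimately show False using n2 by (simp add: algebra_simps power2_eq_square)
  qed

  have miss: "(409 / 1000) * n \<le> m x + m y" if "x \<in> V" "y \<in> same s x" for x y
    using opp_le_book_miss[OF that(2)] opp[OF that(1)] \<open>b \<le> n / 1000\<close> by (simp add: m_def)

  \<comment> \<open>Otherwise \<open>d x\<close> is as large by maximality of the cut, and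
    \<open>same_cross_miss\<close> yields \<open>Q\<close> above
    \<open>2 * 0.082 * 0.081 = 0.013284\<close> times \<open>n^2\<close>, against
    \<open>Q1\<close>.\<close>
  have h1: "h x \<le> (82 / 1000) * n" if "x \<in> V" for x
  proof (rule ccontr)
    assume "\<not> ?thesis"
    then have h: "(82 / 1000) * n < h x" by simp
    then have d: "(82 / 1000) * n < d x" using max[OF that] by (simp add: h_def d_def)
    have "((82 / 1000) * n) * ((81 / 1000) * n) \<le> h x * (d x - b)" "((82 / 1000) * n) * ((81 / 1000) * n) \<le> d x * (h x - b)"
      using h d \<open>b \<le> n / 1000\<close> \<open>n > 0\<close> by (intro mult_mono; simp)+
    then have "2 * (((82 / 1000) * n) * ((81 / 1000) * n)) \<le> Q"
      using same_cross_miss[of s x] by (simp add: h_def d_def Q_def m_def)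
    then show False using Q1 n2 by (simp add: power2_eq_square)
  qed

  \<comment> \<open>The bootstrap: double counting \<open>m x + m y\<close> over inner adjacent
    pairs, bounded below by \<open>miss\<close> and above by \<open>h1\<close>, gives the ratio
    \<open>164/409 < 1/2\<close>. Substituted into \<open>QH\<close>, this improves \<open>Q\<close>
    from order \<open>n^2\<close> to order \<open>t * n\<close>.\<close>
  have "H \<le> Q / 2"
  proof -
    have const: "(\<Sum>x\<in>V. \<Sum>y\<in>same s x. c) = c * H" for c
      unfolding H_def h_def by (simp add: sum_distrib_left mult.commute)
    have "(409 / 1000) * n * H = (\<Sum>x\<in>V. \<Sum>y\<in>same s x. (409 / 1000) * n)"
      by (rule const[symmetric])
    also have "\<dots> \<le> (\<Sum>x\<in>V. \<Sum>y\<in>same s x. m x + m y)"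
      by (intro sum_mono miss)
    also have "\<dots> = 2 * (\<Sum>x\<in>V. h x * m x)"
      by (simp add: sum.distrib sum_same h_def)
    also have "\<dots> \<le> 2 * (\<Sum>x\<in>V. ((82 / 1000) * n) * m x)"
      by (intro mult_left_mono sum_mono mult_right_mono h1 nonneg) auto
    also have "\<dots> = (164 / 1000) * n * Q" unfolding Q_def by (simp add: sum_distrib_left mult.assoc)
    finally have "(409 / 1000) * H \<le> (164 / 1000) * Q" using \<open>n > 0\<close> by simp
    then show ?thesis using Q0 by simp
  qed
  then have Q2: "Q \<le> 4 * (t * n)" using QH by simp

  \<comment> \<open>The threshold is just below half of \<open>409/1000\<close>, so each inner edge
    has an end in \<open>X\<close>.\<close>
  define X where "X = {v \<in> V. m v \<ge> (2 / 10) * n}"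
  define Y where "Y = {v \<in> V. m v \<ge> 10 * t}"
  have "(2 / 10) * n * real (card X) \<le> Q"
    unfolding Q_def m_def by (rule card_times_threshold_le_sum) (use finite_V in \<open>auto simp: X_def m_def\<close>)
  with Q2 have "n * real (card X) \<le> n * (20 * t)" by (simp add: algebra_simps)
  then have X: "real (card X) \<le> 20 * t" using \<open>n > 0\<close> by simp
  have "10 * t * real (card Y) \<le> Q"
    unfolding Q_def m_def by (rule card_times_threshold_le_sum) (use finite_V in \<open>auto simp: Y_def m_def\<close>)
  with Q2 have "t * real (card Y) \<le> t * ((4 / 10) * n)" by (simp add: algebra_simps)
  then have Y: "real (card Y) \<le> (4 / 10) * n" using \<open>t > 0\<close> by simp
  have fin: "finite X" "finite Y" using finite_V by (auto simp: X_def Y_def)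

  \<comment> \<open>If \<open>h w\<close> reaches \<open>C\<close>, it exceeds \<open>b\<close> by
    at least the threshold \<open>10 * t\<close> of \<open>Y\<close>; this puts both ends of the
    cross edges served by \<open>w\<close> into \<open>Y\<close>.\<close>
  define C where "C = b + 10 * t"
  define W where "W = {w \<in> X. h w < C}"
  define T where "T w = (SIGMA u:same s w. cross s w \<inter> N u)" for w
  have finT: "finite (T w)" for w by (simp add: T_def)
  have apex: "(u, v) \<in> (\<Union>w\<in>W. T w) \<union> Y \<times> Y"
    if "w \<in> N u" "w \<in> N v" "v \<in> N u" "s w = s u" "s v \<noteq> s u" "u \<notin> X" for u v w
  proof -
    have V: "u \<in> V" "v \<in> V" "w \<in> V" using that N_subset N_sym by blast+
    have in_sets: "u \<in> same s w" "v \<in> cross s w"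
      using that N_sym by (auto simp: same_def cross_def)
    have "w \<in> X" using miss[OF \<open>w \<in> V\<close> in_sets(1)] \<open>u \<notin> X\<close> V \<open>n > 0\<close> by (simp add: X_def)
    show ?thesis
    proof (cases "h w < C")
      case True
      then show ?thesis using in_sets \<open>w \<in> X\<close> that by (auto simp: W_def T_def)
    next
      case False
      have "card (cross s w) \<le> b + card (miss s u)"
        using in_sets N_subset by (intro card_le_book_miss[of u w]) (auto simp: same_def cross_def opp_def)
      moreover have "card (same s w) \<le> b + card (miss s v)"
        using in_sets N_subset by (intro card_le_book_miss[of v w]) (auto simp: same_def cross_def opp_def)
      ultimately have "u \<in> Y" "v \<in> Y"
        using False V max[OF \<open>w \<in> V\<close>] by (auto simp: Y_def C_def h_def m_def)
      then show ?thesis by simp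
    qed
  qed

  define U where "U = (\<Union>w\<in>W. T w)"
  \<comment> \<open>The apex lies on the side of \<open>u\<close> or of \<open>v\<close>. Pairs in
    \<open>U\<close> start on the side of the apex, so the second case needs the swapped
    copy.\<close>
  have "(SIGMA u:V. cross s u) \<subseteq> X \<times> V \<union> V \<times> X \<union> Y \<times> Y \<union> U \<union> prod.swap ` U"
  proof
    fix p assume "p \<in> (SIGMA u:V. cross s u)"
    then obtain u v where p: "p = (u, v)" "u \<in> V" "v \<in> N u" "s v \<noteq> s u"
      by (auto simp: cross_def)
    obtain w where w: "w \<in> N u" "w \<in> N v" using tri[OF p(3)] by blast
    have "v \<in> V" using p N_subset by blast
    consider "u \<in> X \<or> v \<in> X" | "u \<notin> X" "s w = s u" | "v \<notin> X" "s w = s v"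
      using p(4) by blast
    then show "p \<in> X \<times> V \<union> V \<times> X \<union> Y \<times> Y \<union> U \<union> prod.swap ` U"
    proof cases
      case 1
      then show ?thesis using p \<open>v \<in> V\<close> by auto
    next
      case 2
      then show ?thesis using apex[of w u v] w p unfolding U_def by blast
    next
      case 3
      then have "(v, u) \<in> U \<union> Y \<times> Y"
        using apex[of w v u] w p N_sym[OF p(3)] unfolding U_def by metis
      then show ?thesis using p(1) by (auto intro: rev_image_eqI[of "(v, u)"])
    qed
  qed
  moreover have finU: "finite U" using fin finT by (auto simp: U_def W_def)
  ultimately have "card (SIGMA u:V. cross s u) \<le> card (X \<times> V \<union> V \<times> X \<union> Y \<times> Y \<union> U \<union> prod.swap ` U)"
    using fin finite_V by (intro card_mono) auto
  also have "\<dots> \<le> card (X \<times> V) + card (V \<times> X) + card (Y \<times> Y) + card U + card (prod.swap ` U)"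
    by (meson add_mono card_Un_le le_trans order_refl)
  also have "\<dots> \<le> 2 * card X * card V + card Y * card Y + 2 * card U"
    using card_image_le[OF finU, of prod.swap] by (simp add: card_cartesian_product)
  finally have "real (card (SIGMA u:V. cross s u)) \<le> 2 * real (card X) * n + real (card Y) * real (card Y) + 2 * real (card U)"
    unfolding n_def by (metis (no_types, opaque_lifting) of_nat_le_iff of_nat_add of_nat_mult of_nat_numeral)
  moreover have "real (card (SIGMA u:V. cross s u)) = K"
    using finite_V by (simp add: card_SigmaI K_def d_def)
  moreover have "2 * real (card X) * n \<le> (4 / 100) * n\<^sup>2"
  proof -
    have "real (card X) * n \<le> 20 * t * n" using X \<open>n > 0\<close> by (intro mult_right_mono) auto
    then show ?thesis using tn by linarith
  qed
  moreover have "real (card Y) * real (card Y) \<le> (16 / 100) * n\<^sup>2"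
    using mult_mono[OF Y Y] \<open>n > 0\<close> by (simp add: power2_eq_square)
  moreover have "real (card U) \<le> (88 / 1000) * n\<^sup>2"
  proof -
    have "card U \<le> (\<Sum>w\<in>W. card (T w))"
      unfolding U_def using fin by (intro card_UN_le) (auto simp: W_def)
    then have "real (card U) \<le> (\<Sum>w\<in>W. real (card (T w)))"
      by (metis of_nat_le_iff of_nat_sum)
    also have "\<dots> \<le> (\<Sum>w\<in>W. C * b)"
    proof (rule sum_mono)
      fix w assume "w \<in> W"
      have "real (card (T w)) \<le> h w * b"
        unfolding T_def h_def using card_triangle_pairs[of s w] by (metis of_nat_le_iff of_nat_mult)
      also have "\<dots> \<le> C * b" using \<open>w \<in> W\<close> by (intro mult_right_mono) (auto simp: W_def)
      finally show "real (card (T w)) \<le> C * b" .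
    qed
    also have "\<dots> = real (card W) * (C * b)" by simp
    also have "\<dots> \<le> (20 * t) * (C * b)"
    proof (rule mult_right_mono)
      have "card W \<le> card X" using fin by (intro card_mono) (auto simp: W_def)
      then show "real (card W) \<le> 20 * t" using X by linarith
      show "0 \<le> C * b" using \<open>t > 0\<close> by (simp add: C_def)
    qed
    \<comment> \<open>The two products are exactly those bounded by \<open>tb2\<close> and
      \<open>t2b\<close>, and \<open>220/2500 = 88/1000\<close>.\<close>
    also have "\<dots> = 20 * (t * (real b)\<^sup>2) + 200 * (t\<^sup>2 * b)"
      by (simp add: C_def power2_eq_square algebra_simps)
    also have "\<dots> \<le> (88 / 1000) * n\<^sup>2" using tb2 t2b by simp
    finally show ?thesis .
  qed
  \<comment> \<open>The cover accounts for at most \<open>0.04 + 0.16 + 2 * 0.088 = 0.376\<close>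
    times \<open>n^2\<close> ordered pairs, but \<open>K1\<close> demands
    \<open>0.487\<close>.\<close>
  ultimately show False using K1 n2 by linarith
qed

end

section \<open>Transfer to graphs given by edge sets, and to \<open>gamma\<close>\<close>

lemma bk_ge_card:
  assumes "simple_graph V E" "e \<in> E"
  shows "card (triangles_on V E e) \<le> bk V E"
proof -
  have "E \<subseteq> Pow V" "finite V" using assms(1) by (auto simp: simple_graph_def)
  then have "finite E" by (meson finite_Pow_iff finite_subset)
  then show ?thesis using assms(2) by (auto simp: bk_def intro!: Max_ge)
qed

text \<open>Triangles on an edge correspond to common neighbours of its ends, which turns
  \<open>bk\<close> into the book bound of the locale. Injectivity holds because a common neighbour
  differs from both ends.\<close>

lemma triangles_on_edge:
  assumes "simple_graph V E" "{v, w} \<in> E"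
  shows "triangles_on V E {v, w} =
      (\<lambda>x. {v, w, x}) ` ({x. {v, x} \<in> E} \<inter> {x. {w, x} \<in> E})" (is "_ = ?f ` ?I")
    and "inj_on (\<lambda>x. {v, w, x}) ({x. {v, x} \<in> E} \<inter> {x. {w, x} \<in> E})"
proof -
  have neq: "a \<noteq> b" "a \<in> V" "b \<in> V" if "{a, b} \<in> E" for a b
    using assms(1) that unfolding simple_graph_def by (auto simp: card_insert_if split: if_splits)
  show "triangles_on V E {v, w} = ?f ` ?I"
  proof (intro equalityI subsetI)
    fix T assume "T \<in> triangles_on V E {v, w}"
    then have T: "card T = 3" "\<And>e. e \<subseteq> T \<Longrightarrow> card e = 2 \<Longrightarrow> e \<in> E" "{v, w} \<subseteq> T"
      by (auto simp: triangles_on_def triangles_def)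
    have "finite T" using T(1) by (metis card.infinite zero_neq_numeral)
    then have "card (T - {v, w}) = 1"
      using T(1,3) neq(1)[OF assms(2)] by (simp add: card_Diff_subset)
    then obtain x where x: "T - {v, w} = {x}" by (auto simp: card_1_singleton_iff)
    then have Tx: "T = {v, w, x}" "x \<noteq> v" "x \<noteq> w" using T(3) by auto
    have "{v, x} \<in> E" "{w, x} \<in> E"
      by (rule T(2); use Tx in auto)+
    then show "T \<in> ?f ` ?I" using Tx(1) by blast
  next
    fix T assume "T \<in> ?f ` ?I"
    then obtain x where x: "T = {v, w, x}" "{v, x} \<in> E" "{w, x} \<in> E" by blast
    have ne: "v \<noteq> w" "v \<noteq> x" "w \<noteq> x" using neq(1) assms(2) x by auto
    have "e \<in> E" if "e \<subseteq> T" "card e = 2" for e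
    proof -
      obtain a b where e: "e = {a, b}" "a \<noteq> b" using \<open>card e = 2\<close> by (auto simp: card_2_iff)
      then have "a \<in> {v, w, x}" "b \<in> {v, w, x}" using that(1) x(1) by auto
      then show ?thesis using e assms(2) x(2,3) by (auto simp: insert_commute)
    qed
    moreover have "card T = 3" using x(1) ne by simp
    moreover have "T \<subseteq> V" using x neq assms(2) by auto
    ultimately show "T \<in> triangles_on V E {v, w}"
      using x(1) by (auto simp: triangles_on_def triangles_def)
  qed
  show "inj_on ?f ?I"
  proof (rule inj_onI)
    fix x y assume "x \<in> ?I" "?f x = ?f y"
    then have "x \<noteq> v" "x \<noteq> w" "x \<in> {v, w, y}" using neq(1) by blast+
    then show "x = y" by simp
  qed
qed

lemma handshake:
  assumes "simple_graph V E"
  shows "(\<Sum>v\<in>V. card {w. {v, w} \<in> E}) = 2 * card E"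
proof -
  have E: "E \<subseteq> Pow V" "finite V" "\<And>e. e \<in> E \<Longrightarrow> card e = 2"
    using assms by (auto simp: simple_graph_def)
  then have finE: "finite E" by (meson finite_Pow_iff finite_subset)
  have "card {w. {v, w} \<in> E} = card {e \<in> E. v \<in> e}" for v
  proof (rule bij_betw_same_card[of "\<lambda>w. {v, w}"])
    have "\<exists>w. e = {v, w}" if "e \<in> E" "v \<in> e" for e
      using E(3)[OF that(1)] that(2) by (auto simp: card_2_iff)
    then show "bij_betw (\<lambda>w. {v, w}) {w. {v, w} \<in> E} {e \<in> E. v \<in> e}"
      by (fastforce simp: bij_betw_def inj_on_def doubleton_eq_iff image_iff)
  qed
  then have "(\<Sum>v\<in>V. card {w. {v, w} \<in> E}) = (\<Sum>v\<in>V. card {e \<in> E. v \<in> e})" by simp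
  also have "\<dots> = 2 * card E"
  proof (rule sum_multicount[OF E(2) finE], intro ballI)
    fix e assume "e \<in> E"
    then have "{v \<in> V. v \<in> e} = e" using E(1) by auto
    then show "card {v \<in> V. v \<in> e} = 2" using E(3)[OF \<open>e \<in> E\<close>] by simp
  qed
  finally show ?thesis .
qed

text \<open>The edge count suffices because \<open>n * (n - 2)\<close> is nonnegative, and a third
  vertex completes each edge to a triangle.\<close>

lemma admissible_complete_graph:
  assumes "n \<ge> 3" "f n > 0"
  shows "admissible n f {..<n} {e. e \<subseteq> {..<n} \<and> card e = 2}" (is "admissible n f ?V ?E")
proof -
  have "card ?E = n choose 2" using n_subsets[of ?V 2] by simp
  then have "real (card ?E) = real n * (real n - 1) / 2"
    using assms(1) by (simp add: choose_two real_of_nat_div of_nat_diff)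
  moreover have "0 \<le> (real n - 2) * real n" using assms(1) by (intro mult_nonneg_nonneg) auto
  moreover have "0 < real n * f n" using assms by simp
  ultimately have "(real n)\<^sup>2 / 4 - real n * f n \<le> real (card ?E)"
    by (simp add: power2_eq_square algebra_simps)
  then have "\<lceil>(real n)\<^sup>2 / 4 - real n * f n\<rceil> \<le> int (card ?E)"
    by (simp add: ceiling_le_iff)
  moreover have "triangles_on ?V ?E e \<noteq> {}" if "e \<in> ?E" for e
  proof -
    have e: "e \<subseteq> ?V" "card e = 2" using that by auto
    then have "finite e" using finite_subset by blast
    have "\<not> ?V \<subseteq> e" using e assms(1) card_mono[OF \<open>finite e\<close>, of ?V] by auto
    then obtain x where "x \<in> ?V" "x \<notin> e" by blast
    then have "insert x e \<in> triangles_on ?V ?E e"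
      using e \<open>finite e\<close> by (auto simp: triangles_on_def triangles_def)
    then show ?thesis by blast
  qed
  ultimately show ?thesis by (auto simp: admissible_def simple_graph_def)
qed

lemma admissible_bk_bound:
  fixes f :: "nat \<Rightarrow> real"
  assumes adm: "admissible n f V E" and n: "n > 0" and f: "0 < f n" "f n \<le> n / 1000"
  shows "real (bk V E) \<ge>
    Min {n / (50 * sqrt (f n)), (real n)\<^sup>2 / (2500 * (f n)\<^sup>2), n / 1000}"
proof (rule ccontr)
  let ?b = "bk V E" and ?N = "\<lambda>v. {w. {v, w} \<in> E}"
  assume "\<not> ?thesis"
  then have b: "?b < n / (50 * sqrt (f n))" "?b < (real n)\<^sup>2 / (2500 * (f n)\<^sup>2)" "?b \<le> n / 1000"
    by auto
  have G: "simple_graph V E" "card V = n" "\<lceil>(real n)\<^sup>2 / 4 - n * f n\<rceil> \<le> int (card E)"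
    "\<And>e. e \<in> E \<Longrightarrow> triangles_on V E e \<noteq> {}"
    using adm by (auto simp: admissible_def)
  have V: "finite V" and edge: "\<And>a b. {a, b} \<in> E \<Longrightarrow> a \<noteq> b \<and> a \<in> V \<and> b \<in> V"
    using G(1) unfolding simple_graph_def by (auto simp: card_insert_if split: if_splits)
  have loop: "{v} \<notin> E" for v using edge[of v v] by auto
  interpret book_graph V ?N ?b
  proof
    fix v w assume "w \<in> ?N v"
    then have vw: "{v, w} \<in> E" by simp
    show "card (?N v \<inter> ?N w) \<le> ?b"
      using bk_ge_card[OF G(1) vw] triangles_on_edge[OF G(1) vw] by (simp add: card_image)
  qed (use V edge loop in \<open>auto simp: insert_commute\<close>)
  \<comment> \<open>Squaring removes the root and turns the first term of the minimum into the bound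
    on \<open>t * b^2\<close>.\<close>
  have "?b * (50 * sqrt (f n)) < n" using b(1) f by (simp add: pos_less_divide_eq)
  then have "(?b * (50 * sqrt (f n)))\<^sup>2 \<le> (real n)\<^sup>2"
    using f by (intro power_mono) auto
  then have 1: "f n * (real ?b)\<^sup>2 \<le> (real n)\<^sup>2 / 2500"
    using f by (simp add: power_mult_distrib mult_ac)
  have 2: "(f n)\<^sup>2 * ?b \<le> (real n)\<^sup>2 / 2500"
    using b(2) f by (simp add: pos_less_divide_eq mult.commute)
  have "(\<Sum>v\<in>V. real (card (?N v))) = 2 * real (card E)"
    using arg_cong[OF handshake[OF G(1)], of real] by simp
  moreover have "(real n)\<^sup>2 / 4 - n * f n \<le> card E" using G(3) by (simp add: ceiling_le_iff)
  ultimately have 3: "(\<Sum>v\<in>V. real (card (?N v))) \<ge> (real n)\<^sup>2 / 2 - 2 * n * f n"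
    by (simp add: field_simps)
  obtain v w where vw: "w \<in> ?N v" "?N v \<inter> ?N w = {}"
    by (rule edges_not_all_in_triangles[of "f n"]) (use n f b(3) 1 2 3 G(2) in simp_all)
  then have e: "{v, w} \<in> E" by simp
  then have "triangles_on V E {v, w} = {}"
    using triangles_on_edge(1)[OF G(1) e] vw(2) by (simp only: image_empty)
  with G(4)[OF e] show False by contradiction
qed

theorem corollary1p4:
  fixes f :: "nat \<Rightarrow> real" and n :: nat
  assumes f_pos: "\<And>m. m > 0 \<Longrightarrow> f m > 0"
    and n_pos: "n > 0"
    and integral_threshold: "(real n)\<^sup>2 / 4 - real n * f n \<in> \<int>"
    and f_le: "f n \<le> real n / 1000"
  shows "real (gamma n f) \<ge>
    Min {real n / (50 * sqrt (f n)), (real n)\<^sup>2 / (2500 * (f n)\<^sup>2), real n / 1000}"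
proof -
  have "n \<ge> 3"
  proof (rule ccontr)
    assume "\<not> n \<ge> 3"
    \<comment> \<open>The threshold then lies strictly between 0 and 1, so it is not an integer.\<close>
    then have "n = 1 \<or> n = 2" using n_pos by linarith
    then have frac: "0 < (real n)\<^sup>2 / 4 - real n * f n" "(real n)\<^sup>2 / 4 - real n * f n < 1"
      using f_pos[OF n_pos] f_le by auto
    obtain k where "(real n)\<^sup>2 / 4 - real n * f n = of_int k"
      using integral_threshold by (rule Ints_cases)
    with frac show False by simp
  qed
  \<comment> \<open>Existence of an admissible graph ensures that \<open>LEAST\<close> is attained
    by one.\<close>
  then have "\<exists>b V E. admissible n f V E \<and> bk V E = b"
    using admissible_complete_graph f_pos[OF n_pos] by blast
  then have "\<exists>V E. admissible n f V E \<and> bk V E = gamma n f"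
    unfolding gamma_def by (rule LeastI_ex)
  then obtain V E where "admissible n f V E" "bk V E = gamma n f" by blast
  then show ?thesis using admissible_bk_bound[of n f V E] n_pos f_pos f_le by metis
qed

end
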